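(* The class of strongly embeddable groups is closed under extensions of groups with proper length functions. That is, let $1 \to H \to G \to Q \to 1$ be a short exact sequence of countable groups, where $G$ is equipped with a uniformly discrete, proper, left-invariant metric $d_G$, where $H$ (identified with a normal subgroup of $G$) is equipped with the restriction of $d_G$, and where $Q \cong G/H$ is equipped with the quotient metric $d(aH,bH) = \min\{ d_G(a',b') : a' \in aH,\ b' \in bH\}$. If $H$ and $Q$ are strongly embeddable, then $G$ is strongly embeddable.
   Context: A metric is uniformly discrete if distinct points are at distance at least some fixed $\delta>0$; a metric on a group is proper if every ball is finite. $B_S(x)=\{y : d(x,y)<S\}$ denotes the ball of radius $S$ centered at $x$. A uniformly discrete metric space $(X,d)$ with bounded geometry (for every $r>0$ the cardinality of balls of radius $r$ is uniformly bounded) is strongly embeddable if for every $R,\epsilon>0$ there exists a map $\beta : X \to \ell^2(X)$, $x \mapsto \beta_x$, with $\|\beta_x\|=1$ for each $x\in X$, such that: (1) if $d(x,y)\le R$ then $\|\beta_x-\beta_y\|\le\epsilon$; (2) $\lim_{S\to\infty}\sup_{x\in X}\sum_{w\notin B_S(x)}|\beta_x(w)|^2=0$. *)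

theory Defs
  imports "HOL-Analysis.Analysis" "HOL-Algebra.Coset"
begin

definition uniformly_discrete :: "'a set \<Rightarrow> ('a \<Rightarrow> 'a \<Rightarrow> real) \<Rightarrow> bool" where
  "uniformly_discrete X d \<longleftrightarrow> (\<exists>\<delta>>0. \<forall>x\<in>X. \<forall>y\<in>X. x \<noteq> y \<longrightarrow> \<delta> \<le> d x y)"

definition bounded_geometry :: "'a set \<Rightarrow> ('a \<Rightarrow> 'a \<Rightarrow> real) \<Rightarrow> bool" where
  "bounded_geometry X d \<longleftrightarrow>
     (\<forall>r>0. \<exists>N::nat. \<forall>x\<in>X. finite (Metric_space.mball X d x r) \<and> card (Metric_space.mball X d x r) \<le> N)"

definition proper_metric :: "'a set \<Rightarrow> ('a \<Rightarrow> 'a \<Rightarrow> real) \<Rightarrow> bool" where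
  "proper_metric X d \<longleftrightarrow> (\<forall>x\<in>X. \<forall>r. finite (Metric_space.mball X d x r))"

definition left_invariant :: "('a, 'm) monoid_scheme \<Rightarrow> ('a \<Rightarrow> 'a \<Rightarrow> real) \<Rightarrow> bool" where
  "left_invariant G d \<longleftrightarrow>
     (\<forall>g\<in>carrier G. \<forall>x\<in>carrier G. \<forall>y\<in>carrier G. d (g \<otimes>\<^bsub>G\<^esub> x) (g \<otimes>\<^bsub>G\<^esub> y) = d x y)"

text \<open>Elements of \<open>\<ell>\<^sup>2(X)\<close> are represented by functions on the whole type that vanish off \<open>X\<close>.\<close>

definition ell2 :: "'a set \<Rightarrow> ('a \<Rightarrow> complex) set" where
  "ell2 X = {f. (\<forall>w. w \<notin> X \<longrightarrow> f w = 0) \<and> (\<lambda>w. (cmod (f w))\<^sup>2) summable_on X}"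

definition ell2_norm :: "'a set \<Rightarrow> ('a \<Rightarrow> complex) \<Rightarrow> real" where
  "ell2_norm X f = sqrt (\<Sum>\<^sub>\<infinity>w\<in>X. (cmod (f w))\<^sup>2)"

text \<open>The real-valued supremum below is meaningful for nonempty \<open>X\<close>, since the tail sums lie
  between \<open>0\<close> and \<open>\<parallel>\<beta>\<^sub>x\<parallel>\<^sup>2 = 1\<close>.\<close>

definition strongly_embeddable :: "'a set \<Rightarrow> ('a \<Rightarrow> 'a \<Rightarrow> real) \<Rightarrow> bool" where
  "strongly_embeddable X d \<longleftrightarrow>
     Metric_space X d \<and> uniformly_discrete X d \<and> bounded_geometry X d \<and>
     (\<forall>R>0. \<forall>\<epsilon>>0. \<exists>\<beta> :: 'a \<Rightarrow> 'a \<Rightarrow> complex.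
        (\<forall>x\<in>X. \<beta> x \<in> ell2 X \<and> ell2_norm X (\<beta> x) = 1) \<and>
        (\<forall>x\<in>X. \<forall>y\<in>X. d x y \<le> R \<longrightarrow> ell2_norm X (\<lambda>w. \<beta> x w - \<beta> y w) \<le> \<epsilon>) \<and>
        ((\<lambda>S::real. SUP x\<in>X. \<Sum>\<^sub>\<infinity>w\<in>X - Metric_space.mball X d x S. (cmod (\<beta> x w))\<^sup>2) \<longlongrightarrow> 0) at_top)"

text \<open>For an epimorphism \<open>p : G \<rightarrow> Q\<close> with kernel \<open>H\<close>, the fibre of \<open>p\<close> over \<open>p a\<close> is the coset
  \<open>aH\<close>, so this is the minimum distance between points of two cosets, transported along
  \<open>Q \<cong> G/H\<close>. \<open>LEAST\<close> is the minimum of a set of reals whenever that minimum exists; it does for a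
  proper left-invariant metric, see \<open>quotient_dist_attained\<close>. The value \<open>0\<close> off the range of \<open>p\<close>
  is only there because \<open>Metric_space\<close> demands symmetry and nonnegativity on the whole type.\<close>

definition quotient_dist ::
  "('a, 'm) monoid_scheme \<Rightarrow> ('a \<Rightarrow> 'b) \<Rightarrow> ('a \<Rightarrow> 'a \<Rightarrow> real) \<Rightarrow> 'b \<Rightarrow> 'b \<Rightarrow> real" where
  "quotient_dist G p d u v =
     (if u \<in> p ` carrier G \<and> v \<in> p ` carrier G
      then LEAST r. \<exists>a\<in>carrier G. \<exists>b\<in>carrier G. p a = u \<and> p b = v \<and> r = d a b
      else 0)"

lemma fibre_eq_coset:
  assumes "group G" "group Q" "p \<in> hom G Q" "a \<in> carrier G"
  shows "{b \<in> carrier G. p b = p a} = a <#\<^bsub>G\<^esub> kernel G Q p"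
proof -
  interpret group_hom G Q p
    using assms by (simp add: group_hom_def group_hom_axioms_def)
  have "b \<in> a <#\<^bsub>G\<^esub> kernel G Q p" if "b \<in> carrier G" "p b = p a" for b
  proof -
    have "b = a \<otimes>\<^bsub>G\<^esub> (inv\<^bsub>G\<^esub> a \<otimes>\<^bsub>G\<^esub> b)"
      using that assms(4) by (simp add: G.m_assoc [symmetric])
    moreover have "inv\<^bsub>G\<^esub> a \<otimes>\<^bsub>G\<^esub> b \<in> kernel G Q p"
      using that assms(4) by (simp add: kernel_def)
    ultimately show ?thesis
      unfolding l_coset_def by blast
  qed
  moreover have "b \<in> carrier G \<and> p b = p a" if "b \<in> a <#\<^bsub>G\<^esub> kernel G Q p" for b
    using that assms(4) by (auto simp: l_coset_def kernel_def)
  ultimately show ?thesis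
    by blast
qed

lemma quotient_dist_attained:
  assumes G: "group G" and Q: "group Q" and p: "p \<in> hom G Q"
    and M: "Metric_space (carrier G) d" and pr: "proper_metric (carrier G) d"
    and inv: "left_invariant G d"
    and a0: "a0 \<in> carrier G" and v: "v \<in> p ` carrier G"
  obtains b where "b \<in> carrier G" "p b = v" "quotient_dist G p d (p a0) v = d a0 b"
    "\<And>a' b'. a' \<in> carrier G \<Longrightarrow> b' \<in> carrier G \<Longrightarrow> p a' = p a0 \<Longrightarrow> p b' = v \<Longrightarrow> d a0 b \<le> d a' b'"
proof -
  interpret group_hom G Q p
    using assms by (simp add: group_hom_def group_hom_axioms_def)
  interpret Metric_space "carrier G" d by fact
  obtain b0 where b0: "b0 \<in> carrier G" "p b0 = v"
    using v by auto
  define B where "B = {b \<in> carrier G. p b = v \<and> d a0 b < d a0 b0 + 1}"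
  have "B \<subseteq> mball a0 (d a0 b0 + 1)"
    using a0 by (auto simp: B_def)
  then have "finite B"
    using pr a0 by (meson proper_metric_def finite_subset)
  moreover have "b0 \<in> B"
    using b0 by (simp add: B_def)
  ultimately obtain b where b: "b \<in> B" and bmin: "\<And>y. y \<in> B \<Longrightarrow> d a0 b \<le> d a0 y"
    using ex_is_arg_min_if_finite [of B "d a0"] by (fastforce simp: is_arg_min_linorder)
  have min1: "d a0 b \<le> d a0 y" if "y \<in> carrier G" "p y = v" for y
    using that bmin [of y] bmin [OF \<open>b0 \<in> B\<close>] by (cases "y \<in> B") (auto simp: B_def)
  have min2: "d a0 b \<le> d a' b'"
    if "a' \<in> carrier G" "b' \<in> carrier G" "p a' = p a0" "p b' = v" for a' b'
  proof -
    define g where "g = a0 \<otimes>\<^bsub>G\<^esub> inv\<^bsub>G\<^esub> a'"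
    have g: "g \<in> carrier G" "p g = \<one>\<^bsub>Q\<^esub>" "g \<otimes>\<^bsub>G\<^esub> a' = a0"
      using that a0 by (auto simp: g_def G.m_assoc)
    have "d a' b' = d a0 (g \<otimes>\<^bsub>G\<^esub> b')"
      using inv g that unfolding left_invariant_def by metis
    moreover have "p (g \<otimes>\<^bsub>G\<^esub> b') = v"
      using g that by (metis hom_mult hom_closed H.l_one)
    ultimately show ?thesis
      using min1 g that by simp
  qed
  have "(LEAST r. \<exists>a\<in>carrier G. \<exists>b\<in>carrier G. p a = p a0 \<and> p b = v \<and> r = d a b) = d a0 b"
    using a0 b min2 by (intro Least_equality) (auto simp: B_def)
  then have "quotient_dist G p d (p a0) v = d a0 b"
    using a0 v by (simp add: quotient_dist_def)
  then show thesis
    using that b min2 by (auto simp: B_def)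
qed

lemma Metric_space_quotient_dist:
  assumes G: "group G" and Q: "group Q" and p: "p \<in> epi G Q"
    and M: "Metric_space (carrier G) d" and pr: "proper_metric (carrier G) d"
    and inv: "left_invariant G d"
  shows "Metric_space (carrier Q) (quotient_dist G p d)"
proof -
  have ph: "p \<in> hom G Q" and im: "p ` carrier G = carrier Q"
    using p by (auto simp: epi_def)
  interpret group_hom G Q p
    using G Q ph by (simp add: group_hom_def group_hom_axioms_def)
  interpret Metric_space "carrier G" d by fact
  note att = quotient_dist_attained [OF G Q ph M pr inv]
  show ?thesis
  proof
    fix u v
    show "0 \<le> quotient_dist G p d u v"
    proof (cases "u \<in> p ` carrier G \<and> v \<in> p ` carrier G")
      case True
      then obtain a where "a \<in> carrier G" "u = p a" by auto
      then show ?thesis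
        using True att by (metis nonneg)
    qed (auto simp: quotient_dist_def)
    have "(\<lambda>r. \<exists>a\<in>carrier G. \<exists>b\<in>carrier G. p a = u \<and> p b = v \<and> r = d a b) =
      (\<lambda>r. \<exists>a\<in>carrier G. \<exists>b\<in>carrier G. p a = v \<and> p b = u \<and> r = d a b)"
      using commute by fastforce
    then show "quotient_dist G p d u v = quotient_dist G p d v u"
      unfolding quotient_dist_def by auto
  next
    fix u v
    assume u: "u \<in> carrier Q" and v: "v \<in> carrier Q"
    then obtain a where a: "a \<in> carrier G" "u = p a"
      using im by auto
    obtain b where b: "b \<in> carrier G" "p b = v" "quotient_dist G p d (p a) v = d a b"
      "\<And>a' b'. a' \<in> carrier G \<Longrightarrow> b' \<in> carrier G \<Longrightarrow> p a' = p a \<Longrightarrow> p b' = v \<Longrightarrow> d a b \<le> d a' b'"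
      using att [OF a(1)] v im by metis
    show "quotient_dist G p d u v = 0 \<longleftrightarrow> u = v"
    proof
      assume "quotient_dist G p d u v = 0"
      then show "u = v"
        using a b by auto
    next
      assume "u = v"
      then have "d a b \<le> d a a"
        using a b(4) by blast
      then show "quotient_dist G p d u v = 0"
        using a b(3) by (simp add: order_antisym)
    qed
  next
    fix u v w
    assume u: "u \<in> carrier Q" and v: "v \<in> carrier Q" and w: "w \<in> carrier Q"
    then obtain a where a: "a \<in> carrier G" "u = p a"
      using im by auto
    obtain b where b: "b \<in> carrier G" "p b = v" "quotient_dist G p d (p a) v = d a b"
      using att [OF a(1)] v im by metis
    obtain c where c: "c \<in> carrier G" "p c = w" "quotient_dist G p d (p b) w = d b c"
      using att [OF b(1)] w im by metis
    obtain c' where c': "quotient_dist G p d (p a) w = d a c'"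
      "\<And>a' b'. a' \<in> carrier G \<Longrightarrow> b' \<in> carrier G \<Longrightarrow> p a' = p a \<Longrightarrow> p b' = w \<Longrightarrow> d a c' \<le> d a' b'"
      using att [OF a(1)] w im by metis
    have "d a c' \<le> d a c"
      using c'(2) a c by blast
    also have "\<dots> \<le> d a b + d b c"
      using triangle a b c by blast
    finally show "quotient_dist G p d u w \<le> quotient_dist G p d u v + quotient_dist G p d v w"
      using a b c c' by simp
  qed
qed

end

theory Submission
  imports Defs
begin

text \<open>Choosing a set-theoretic section of \<open>p\<close> identifies \<open>G\<close> with \<open>Q \<times> H\<close>, each fibre of \<open>p\<close> being
  isometric to \<open>H\<close> by left translation. Let \<open>\<sigma> q x\<close> be a point of the fibre over \<open>q\<close> nearest to \<open>x\<close>;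
  given unit vectors \<open>\<alpha>\<close> for \<open>Q\<close> and \<open>\<gamma>\<close> for \<open>H\<close>, put on the fibre over \<open>q\<close> the vector
  \<open>\<gamma>\<^bsub>\<sigma> q x\<^esub>\<close> weighted by \<open>\<alpha>\<^bsub>p x\<^esub>(q)\<close>. For \<open>d x y \<le> R\<close> and \<open>q\<close> within \<open>S\<close> of \<open>p y\<close>, the points
  \<open>\<sigma> q x\<close> and \<open>\<sigma> q y\<close> are at distance at most \<open>2R + 2S\<close>, while the mass of \<open>\<alpha>\<^bsub>p y\<^esub>\<close> outside that
  ball is uniformly small. So one picks \<open>\<alpha>\<close> first, then \<open>S\<close>, and only then \<open>\<gamma>\<close> for the radius
  \<open>2R + 2S\<close>.\<close>

section \<open>Square sums, unit vectors and tails\<close>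

lemma ell2_norm_le_iff:
  assumes "e \<ge> 0"
  shows "ell2_norm X f \<le> e \<longleftrightarrow> (\<Sum>\<^sub>\<infinity>w\<in>X. (cmod (f w))\<^sup>2) \<le> e\<^sup>2"
  unfolding ell2_norm_def using assms by (meson real_le_rsqrt real_sqrt_le_iff real_sqrt_unique sqrt_le_D real_le_lsqrt infsum_nonneg zero_le_power2)

text \<open>\<open>has_sum 1\<close> carries summability and the value of the norm together, so all
  later estimates are made on squared sums.\<close>

lemma unit_ell2_iff:
  "f \<in> ell2 X \<and> ell2_norm X f = 1 \<longleftrightarrow>
     (\<forall>w. w \<notin> X \<longrightarrow> f w = 0) \<and> ((\<lambda>w. (cmod (f w))\<^sup>2) has_sum 1) X"
  unfolding ell2_def ell2_norm_def has_sum_iff by auto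

text \<open>From 2ab \<le> a^2 + b^2. At the cost of a factor 2, this termwise bound takes the place
  of the triangle inequality in \<open>ell2\<close>.\<close>

lemma cmod_add_power2_le: "(cmod (a + b))\<^sup>2 \<le> 2 * (cmod a)\<^sup>2 + 2 * (cmod b)\<^sup>2"
proof -
  have "(cmod (a + b))\<^sup>2 \<le> (cmod a + cmod b)\<^sup>2"
    by (intro power_mono norm_triangle_ineq) auto
  also have "\<dots> \<le> 2 * (cmod a)\<^sup>2 + 2 * (cmod b)\<^sup>2"
    using sum_squares_bound [of "cmod a" "cmod b"] by (simp add: power2_sum)
  finally show ?thesis .
qed

text \<open>Termwise, \<open>cmod_add_power2_le\<close> gives 2 + 2. The crude bound serves on
  fibres too far away for closeness to be available.\<close>

lemma unit_ell2_diff: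
  assumes f: "((\<lambda>w. (cmod (f w))\<^sup>2) has_sum 1) X" and g: "((\<lambda>w. (cmod (g w))\<^sup>2) has_sum 1) X"
  shows "(\<lambda>w. (cmod (f w - g w))\<^sup>2) summable_on X" "(\<Sum>\<^sub>\<infinity>w\<in>X. (cmod (f w - g w))\<^sup>2) \<le> 4"
proof -
  have s: "((\<lambda>w. 2 * (cmod (f w))\<^sup>2 + 2 * (cmod (g w))\<^sup>2) has_sum (2 * 1 + 2 * 1)) X"
    by (intro has_sum_add has_sum_cmult_right f g)
  have le: "(cmod (f w - g w))\<^sup>2 \<le> 2 * (cmod (f w))\<^sup>2 + 2 * (cmod (g w))\<^sup>2" for w
    using cmod_add_power2_le [of "f w" "- g w"] by simp
  show sm: "(\<lambda>w. (cmod (f w - g w))\<^sup>2) summable_on X"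
    by (rule summable_on_comparison_test [OF has_sum_imp_summable [OF s]]) (use le in auto)
  show "(\<Sum>\<^sub>\<infinity>w\<in>X. (cmod (f w - g w))\<^sup>2) \<le> 4"
    using has_sum_mono [OF has_sum_infsum [OF sm] s] le by simp
qed

text \<open>Rewrites a tail as a sum over all of \<open>A\<close> with some terms set to 0, so that
  it can be added termwise to full sums.\<close>

lemma has_sum_restrict:
  assumes "(f has_sum s) (A - B)"
  shows "((\<lambda>w. if w \<in> B then 0 else f w) has_sum s) A"
  by (rule has_sum_cong_neutral [THEN iffD1, OF _ _ _ assms]) auto

lemma tail_sum:
  fixes f :: "'a \<Rightarrow> complex"
  assumes f: "((\<lambda>w. (cmod (f w))\<^sup>2) has_sum s) X"
  shows "(\<lambda>w. (cmod (f w))\<^sup>2) summable_on (X - B)"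
    "0 \<le> (\<Sum>\<^sub>\<infinity>w\<in>X - B. (cmod (f w))\<^sup>2)" "(\<Sum>\<^sub>\<infinity>w\<in>X - B. (cmod (f w))\<^sup>2) \<le> s"
proof -
  show sm: "(\<lambda>w. (cmod (f w))\<^sup>2) summable_on (X - B)"
    by (rule summable_on_subset_banach [OF has_sum_imp_summable [OF f]]) auto
  show "0 \<le> (\<Sum>\<^sub>\<infinity>w\<in>X - B. (cmod (f w))\<^sup>2)"
    by (rule infsum_nonneg) auto
  show "(\<Sum>\<^sub>\<infinity>w\<in>X - B. (cmod (f w))\<^sup>2) \<le> s"
    by (rule has_sum_mono_neutral [OF has_sum_infsum [OF sm] f]) auto
qed

text \<open>Tails of unit vectors lie in [0, 1], so over a nonempty index set the real supremum is a
  genuine one, and its convergence to 0 is a uniform smallness of the tails.\<close>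

lemma tendsto_SUP_tail_iff:
  fixes \<beta> :: "'b \<Rightarrow> 'a \<Rightarrow> complex" and B :: "'b \<Rightarrow> real \<Rightarrow> 'a set"
  assumes "I \<noteq> {}" and unit: "\<And>x. x \<in> I \<Longrightarrow> ((\<lambda>w. (cmod (\<beta> x w))\<^sup>2) has_sum 1) X"
  shows "((\<lambda>S. SUP x\<in>I. \<Sum>\<^sub>\<infinity>w\<in>X - B x S. (cmod (\<beta> x w))\<^sup>2) \<longlongrightarrow> 0) at_top \<longleftrightarrow>
    (\<forall>\<eta>>0. \<exists>S0. \<forall>S\<ge>S0. \<forall>x\<in>I. (\<Sum>\<^sub>\<infinity>w\<in>X - B x S. (cmod (\<beta> x w))\<^sup>2) \<le> \<eta>)" (is "?L \<longleftrightarrow> ?R")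
proof -
  define t where "t x S = (\<Sum>\<^sub>\<infinity>w\<in>X - B x S. (cmod (\<beta> x w))\<^sup>2)" for x S
  have t: "0 \<le> t x S" "t x S \<le> 1" if "x \<in> I" for x S
    using tail_sum [OF unit [OF that], of "B x S"] by (auto simp: t_def)
  have bdd: "bdd_above ((\<lambda>x. t x S) ` I)" for S
    by (rule bdd_aboveI2 [OF t(2)])
  have up: "t x S \<le> (SUP x\<in>I. t x S)" if "x \<in> I" for x S
    by (rule cSUP_upper [OF that bdd])
  have nn: "0 \<le> (SUP x\<in>I. t x S)" for S
    using assms(1) t(1) up by (meson ex_in_conv order_trans)
  have "((\<lambda>S. SUP x\<in>I. t x S) \<longlongrightarrow> 0) at_top \<longleftrightarrow> (\<forall>\<eta>>0. \<exists>S0. \<forall>S\<ge>S0. \<forall>x\<in>I. t x S \<le> \<eta>)"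
  proof
    assume L: "((\<lambda>S. SUP x\<in>I. t x S) \<longlongrightarrow> 0) at_top"
    show "\<forall>\<eta>>0. \<exists>S0. \<forall>S\<ge>S0. \<forall>x\<in>I. t x S \<le> \<eta>"
    proof (intro allI impI)
      fix \<eta> :: real assume "\<eta> > 0"
      then have "\<forall>\<^sub>F S in at_top. (SUP x\<in>I. t x S) < \<eta>"
        by (rule order_tendstoD(2) [OF L])
      then show "\<exists>S0. \<forall>S\<ge>S0. \<forall>x\<in>I. t x S \<le> \<eta>"
        unfolding eventually_at_top_linorder using up by (meson less_imp_le order_trans)
    qed
  next
    assume R: "\<forall>\<eta>>0. \<exists>S0. \<forall>S\<ge>S0. \<forall>x\<in>I. t x S \<le> \<eta>"
    show "((\<lambda>S. SUP x\<in>I. t x S) \<longlongrightarrow> 0) at_top"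
    proof (rule order_tendstoI)
      fix \<eta> :: real assume "0 < \<eta>"
      \<comment> \<open>The supremum of values at most \<open>\<eta> / 2\<close> is at most
        \<open>\<eta> / 2\<close>, which restores the strict inequality.\<close>
      then obtain S0 where S0: "\<And>S x. S \<ge> S0 \<Longrightarrow> x \<in> I \<Longrightarrow> t x S \<le> \<eta> / 2"
        using R by (meson half_gt_zero)
      have "(SUP x\<in>I. t x S) < \<eta>" if "S \<ge> S0" for S
        using cSUP_least [OF assms(1), of "\<lambda>x. t x S" "\<eta> / 2"] S0 [OF that] \<open>0 < \<eta>\<close> by fastforce
      then show "\<forall>\<^sub>F S in at_top. (SUP x\<in>I. t x S) < \<eta>"
        unfolding eventually_at_top_linorder by blast
    next
      fix \<eta> :: real assume "\<eta> < 0"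
      then show "\<forall>\<^sub>F S in at_top. \<eta> < (SUP x\<in>I. t x S)"
        by (intro always_eventually allI) (rule less_le_trans [OF _ nn])
    qed
  qed
  then show ?thesis unfolding t_def .
qed

lemma strongly_embeddableE:
  assumes "strongly_embeddable X d" "X \<noteq> {}" "0 < R" "0 < \<epsilon>"
  obtains \<beta> :: "'a \<Rightarrow> 'a \<Rightarrow> complex"
  where "\<And>x. x \<in> X \<Longrightarrow> ((\<lambda>w. (cmod (\<beta> x w))\<^sup>2) has_sum 1) X"
    "\<And>x y. x \<in> X \<Longrightarrow> y \<in> X \<Longrightarrow> d x y \<le> R \<Longrightarrow> (\<Sum>\<^sub>\<infinity>w\<in>X. (cmod (\<beta> x w - \<beta> y w))\<^sup>2) \<le> \<epsilon>\<^sup>2"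
    "\<And>\<eta>. \<eta> > 0 \<Longrightarrow> \<exists>S0. \<forall>S\<ge>S0. \<forall>x\<in>X.
      (\<Sum>\<^sub>\<infinity>w\<in>X - Metric_space.mball X d x S. (cmod (\<beta> x w))\<^sup>2) \<le> \<eta>"
proof -
  note E = assms(1) [unfolded strongly_embeddable_def, THEN conjunct2, THEN conjunct2, THEN conjunct2,
      rule_format, OF assms(3,4)]
  from E obtain \<beta> :: "'a \<Rightarrow> 'a \<Rightarrow> complex"
    where \<beta>1: "\<forall>x\<in>X. \<beta> x \<in> ell2 X \<and> ell2_norm X (\<beta> x) = 1"
      and \<beta>2: "\<forall>x\<in>X. \<forall>y\<in>X. d x y \<le> R \<longrightarrow> ell2_norm X (\<lambda>w. \<beta> x w - \<beta> y w) \<le> \<epsilon>"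
      and \<beta>3: "((\<lambda>S. SUP x\<in>X. \<Sum>\<^sub>\<infinity>w\<in>X - Metric_space.mball X d x S. (cmod (\<beta> x w))\<^sup>2) \<longlongrightarrow> 0) at_top"
    by (elim exE conjE)
  have unit: "((\<lambda>w. (cmod (\<beta> x w))\<^sup>2) has_sum 1) X" if "x \<in> X" for x
    using \<beta>1 [rule_format, OF that] unfolding unit_ell2_iff ..
  show thesis
  proof (rule that [OF unit])
    show "(\<Sum>\<^sub>\<infinity>w\<in>X. (cmod (\<beta> x w - \<beta> y w))\<^sup>2) \<le> \<epsilon>\<^sup>2" if "x \<in> X" "y \<in> X" "d x y \<le> R" for x y
      using \<beta>2 [rule_format, OF that] assms(4) by (simp add: ell2_norm_le_iff)
    show "\<exists>S0. \<forall>S\<ge>S0. \<forall>x\<in>X. (\<Sum>\<^sub>\<infinity>w\<in>X - Metric_space.mball X d x S. (cmod (\<beta> x w))\<^sup>2) \<le> \<eta>"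
      if "\<eta> > 0" for \<eta>
      using iffD1 [OF tendsto_SUP_tail_iff [OF assms(2) unit, where B = "Metric_space.mball X d"] \<beta>3] that
      by blast
  qed
qed

section \<open>Metric fibrations with isometric fibres\<close>

text \<open>What the argument retains of a group extension: \<open>p\<close> is the projection to
  the base, \<open>k\<close> the coordinate in the model fibre. The coordinates need not respect
  distances between different fibres; across fibres only \<open>nearest_point\<close> and
  \<open>contraction\<close> give control.\<close>

locale metric_fibration = X: Metric_space X d + Q: Metric_space Q dQ + K: Metric_space K dK
  for X :: "'a set" and d and Q :: "'b set" and dQ and K :: "'c set" and dK +
  fixes p :: "'a \<Rightarrow> 'b" and k :: "'a \<Rightarrow> 'c"
  assumes bij: "bij_betw (\<lambda>w. (p w, k w)) X (Q \<times> K)"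
    and fibre_isometry: "\<And>z w. z \<in> X \<Longrightarrow> w \<in> X \<Longrightarrow> p z = p w \<Longrightarrow> dK (k z) (k w) = d z w"
    and nearest_point: "\<And>x q. x \<in> X \<Longrightarrow> q \<in> Q \<Longrightarrow> \<exists>z\<in>X. p z = q \<and> d x z = dQ (p x) q"
    and contraction: "\<And>x y. x \<in> X \<Longrightarrow> y \<in> X \<Longrightarrow> dQ (p x) (p y) \<le> d x y"
begin

lemma p_closed: "x \<in> X \<Longrightarrow> p x \<in> Q" and k_closed: "x \<in> X \<Longrightarrow> k x \<in> K"
  using bij_betwE [OF bij] by auto

definition \<sigma> :: "'b \<Rightarrow> 'a \<Rightarrow> 'a" where
  "\<sigma> q x = (SOME z. z \<in> X \<and> p z = q \<and> d x z = dQ (p x) q)"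

lemma \<sigma>:
  assumes "x \<in> X" "q \<in> Q"
  shows "\<sigma> q x \<in> X" "p (\<sigma> q x) = q" "d x (\<sigma> q x) = dQ (p x) q"
  using someI_ex [of "\<lambda>z. z \<in> X \<and> p z = q \<and> d x z = dQ (p x) q"] nearest_point [OF assms]
  unfolding \<sigma>_def by blast+

text \<open>Travel from \<open>\<sigma> q x\<close> through \<open>x\<close> and \<open>y\<close> to
  \<open>\<sigma> q y\<close>. The outer legs have lengths \<open>dQ (p x) q\<close> and
  \<open>dQ (p y) q\<close>; replacing the former by the latter costs a second
  \<open>d x y\<close>.\<close>

lemma dist_\<sigma>_le:
  assumes "x \<in> X" "y \<in> X" "q \<in> Q"
  shows "dK (k (\<sigma> q x)) (k (\<sigma> q y)) \<le> 2 * d x y + 2 * dQ (p y) q"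
proof -
  note sx = \<sigma> [OF assms(1,3)] and sy = \<sigma> [OF assms(2,3)]
  have "dK (k (\<sigma> q x)) (k (\<sigma> q y)) = d (\<sigma> q x) (\<sigma> q y)"
    using sx sy by (intro fibre_isometry) auto
  also have "\<dots> \<le> d (\<sigma> q x) x + d x y + d y (\<sigma> q y)"
    using X.triangle [of "\<sigma> q x" x "\<sigma> q y"] X.triangle [of x y "\<sigma> q y"] sx sy assms by simp
  also have "\<dots> = dQ (p x) q + d x y + dQ (p y) q"
    using sx sy X.commute by metis
  also have "dQ (p x) q \<le> d x y + dQ (p y) q"
    using Q.triangle [of "p x" "p y" q] contraction [of x y] assms p_closed by force
  finally show ?thesis by simp
qed

text \<open>Tonelli: for nonnegative terms the iterated sum over \<open>Q\<close> and
  \<open>K\<close> gives the sum over the product, which \<open>bij\<close> carries to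
  \<open>X\<close>.\<close>

lemma fibrewise_has_sum:
  fixes f :: "'b \<Rightarrow> 'c \<Rightarrow> real"
  assumes "\<And>q. q \<in> Q \<Longrightarrow> (f q has_sum g q) K" "\<And>q h. f q h \<ge> 0" "(g has_sum s) Q"
  shows "((\<lambda>w. f (p w) (k w)) has_sum s) X"
proof -
  have "(\<lambda>(q, h). f q h) summable_on Q \<times> K"
    by (rule summable_on_SigmaI [where g = g]) (use assms has_sum_imp_summable in auto)
  then have "((\<lambda>(q, h). f q h) has_sum s) (Q \<times> K)"
    by (intro has_sum_SigmaI [where g = g]) (use assms in auto)
  then show ?thesis
    using has_sum_reindex_bij_betw [OF bij, of "\<lambda>(q, h). f q h" s] by simp
qed

text \<open>\<open>\<gamma>\<close> lives on the model fibre, hence the coordinates \<open>k\<close>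
  of both the nearest point and \<open>w\<close>. Membership in \<open>ell2 X\<close> forces the
  value 0 off \<open>X\<close>.\<close>

definition glue :: "('b \<Rightarrow> 'b \<Rightarrow> complex) \<Rightarrow> ('c \<Rightarrow> 'c \<Rightarrow> complex) \<Rightarrow> 'a \<Rightarrow> 'a \<Rightarrow> complex" where
  "glue \<alpha> \<gamma> x w = (if w \<in> X then \<alpha> (p x) (p w) * \<gamma> (k (\<sigma> (p w) x)) (k w) else 0)"

context
  fixes \<alpha> \<gamma>
  assumes \<alpha>: "\<And>q. q \<in> Q \<Longrightarrow> ((\<lambda>w. (cmod (\<alpha> q w))\<^sup>2) has_sum 1) Q"
    and \<gamma>: "\<And>h. h \<in> K \<Longrightarrow> ((\<lambda>w. (cmod (\<gamma> h w))\<^sup>2) has_sum 1) K"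
begin

text \<open>The vectors \<open>\<gamma>\<close> being unit, the fibre over \<open>q\<close>
  contributes exactly the squared modulus of \<open>\<alpha> (p x) q\<close>, and these add up to
  1.\<close>

lemma glue_unit:
  assumes x: "x \<in> X"
  shows "((\<lambda>w. (cmod (glue \<alpha> \<gamma> x w))\<^sup>2) has_sum 1) X"
proof -
  have "((\<lambda>h. (cmod (\<alpha> (p x) q))\<^sup>2 * (cmod (\<gamma> (k (\<sigma> q x)) h))\<^sup>2) has_sum (cmod (\<alpha> (p x) q))\<^sup>2 * 1) K"
    if "q \<in> Q" for q
    using x that \<sigma> k_closed by (intro has_sum_cmult_right \<gamma>) blast
  then have "((\<lambda>w. (cmod (\<alpha> (p x) (p w)))\<^sup>2 * (cmod (\<gamma> (k (\<sigma> (p w) x)) (k w)))\<^sup>2) has_sum 1) X"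
    by (rule fibrewise_has_sum) (use \<alpha> [OF p_closed [OF x]] in auto)
  then show ?thesis
    by (rule has_sum_cong [THEN iffD1, rotated]) (simp add: glue_def norm_mult power_mult_distrib)
qed

text \<open>Changing the weight costs \<open>a\<close>, since the \<open>\<gamma>\<close> are unit.
  Changing the fibre vector costs the average of \<open>D q\<close> with weights from
  \<open>\<alpha> (p y)\<close>: at most \<open>c\<close> on the ball of radius \<open>S\<close>,
  and at most 4 outside it, where the total weight is at most \<open>t\<close>. The factors 2 come
  from \<open>cmod_add_power2_le\<close>.\<close>

lemma glue_close:
  assumes x: "x \<in> X" and y: "y \<in> X" and "d x y \<le> R" and c0: "0 \<le> c"
    and ca: "(\<Sum>\<^sub>\<infinity>q\<in>Q. (cmod (\<alpha> (p x) q - \<alpha> (p y) q))\<^sup>2) \<le> a"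
    and ta: "(\<Sum>\<^sub>\<infinity>q\<in>Q - Q.mball (p y) S. (cmod (\<alpha> (p y) q))\<^sup>2) \<le> t"
    and cg: "\<And>g h. g \<in> K \<Longrightarrow> h \<in> K \<Longrightarrow> dK g h \<le> 2 * R + 2 * S \<Longrightarrow>
      (\<Sum>\<^sub>\<infinity>w\<in>K. (cmod (\<gamma> g w - \<gamma> h w))\<^sup>2) \<le> c"
  shows "(\<Sum>\<^sub>\<infinity>w\<in>X. (cmod (glue \<alpha> \<gamma> x w - glue \<alpha> \<gamma> y w))\<^sup>2) \<le> 2 * a + 2 * (c + 4 * t)"
proof -
  define D where "D q = (\<Sum>\<^sub>\<infinity>h\<in>K. (cmod (\<gamma> (k (\<sigma> q x)) h - \<gamma> (k (\<sigma> q y)) h))\<^sup>2)" for q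
  define T where "T = (\<Sum>\<^sub>\<infinity>q\<in>Q - Q.mball (p y) S. (cmod (\<alpha> (p y) q))\<^sup>2)"
  define A where "A = (\<Sum>\<^sub>\<infinity>q\<in>Q. (cmod (\<alpha> (p x) q - \<alpha> (p y) q))\<^sup>2)"
  have px: "p x \<in> Q" and py: "p y \<in> Q"
    using x y p_closed by auto
  have ks: "k (\<sigma> q x) \<in> K" "k (\<sigma> q y) \<in> K" if "q \<in> Q" for q
    using that x y \<sigma> k_closed by blast+
  note diff = unit_ell2_diff [OF \<gamma> \<gamma>, OF ks]
  have D4: "D q \<le> 4" if "q \<in> Q" for q
    using diff(2) that by (simp add: D_def)
  \<comment> \<open>On this ball \<open>dist_\<sigma>_le\<close> yields exactly the radius demanded
    in \<open>cg\<close>.\<close>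
  have Dc: "D q \<le> c" if "q \<in> Q.mball (p y) S" for q
  proof -
    have q: "q \<in> Q" "dQ (p y) q < S" using that by auto
    have "dK (k (\<sigma> q x)) (k (\<sigma> q y)) \<le> 2 * R + 2 * S"
      using dist_\<sigma>_le [OF x y q(1)] q(2) \<open>d x y \<le> R\<close> by linarith
    then show ?thesis
      unfolding D_def by (intro cg ks q)
  qed
  have D0: "0 \<le> D q" for q
    unfolding D_def by (rule infsum_nonneg) auto
  define f where "f q h = 2 * (cmod (\<alpha> (p x) q - \<alpha> (p y) q))\<^sup>2 * (cmod (\<gamma> (k (\<sigma> q x)) h))\<^sup>2
      + 2 * (cmod (\<alpha> (p y) q))\<^sup>2 * (cmod (\<gamma> (k (\<sigma> q x)) h - \<gamma> (k (\<sigma> q y)) h))\<^sup>2" for q h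
  define g where "g q = 2 * (cmod (\<alpha> (p x) q - \<alpha> (p y) q))\<^sup>2 * 1 + 2 * (cmod (\<alpha> (p y) q))\<^sup>2 * D q" for q
  have fg: "(f q has_sum g q) K" if "q \<in> Q" for q
    unfolding f_def g_def D_def using that ks diff(1)
    by (intro has_sum_add has_sum_cmult_right \<gamma> has_sum_infsum)
  \<comment> \<open>A majorant of \<open>g\<close> with an explicit sum: \<open>c\<close> is charged
    on every fibre, at total weight 1, and 4 is added on the far ones.\<close>
  define G where "G q = 2 * (cmod (\<alpha> (p x) q - \<alpha> (p y) q))\<^sup>2
      + 2 * (c * (cmod (\<alpha> (p y) q))\<^sup>2 + 4 * (if q \<in> Q.mball (p y) S then 0 else (cmod (\<alpha> (p y) q))\<^sup>2))" for q
  have G: "(G has_sum (2 * A + 2 * (c * 1 + 4 * T))) Q"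
    unfolding G_def A_def T_def
    by (intro has_sum_add has_sum_cmult_right has_sum_restrict has_sum_infsum \<alpha> px py
        unit_ell2_diff(1) tail_sum(1) [OF \<alpha>])
  have gG: "g q \<le> G q" if q: "q \<in> Q" for q
  proof (cases "q \<in> Q.mball (p y) S")
    case True
    then show ?thesis
      using mult_left_mono [OF Dc [OF True], of "(cmod (\<alpha> (p y) q))\<^sup>2"] by (simp add: g_def G_def mult.commute)
  next
    case False
    moreover have "(cmod (\<alpha> (p y) q))\<^sup>2 * D q \<le> (cmod (\<alpha> (p y) q))\<^sup>2 * 4"
      by (rule mult_left_mono [OF D4 [OF q]]) auto
    moreover have "0 \<le> c * (cmod (\<alpha> (p y) q))\<^sup>2" using c0 by simp
    ultimately show ?thesis
      by (simp add: g_def G_def del: Q.in_mball)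
  qed
  have g: "g summable_on Q"
    by (rule summable_on_comparison_test [OF has_sum_imp_summable [OF G]])
      (use gG D0 in \<open>auto simp: g_def\<close>)
  have F: "((\<lambda>w. f (p w) (k w)) has_sum infsum g Q) X"
    by (rule fibrewise_has_sum [OF fg]) (auto simp: f_def has_sum_infsum [OF g])
  have "(cmod (glue \<alpha> \<gamma> x w - glue \<alpha> \<gamma> y w))\<^sup>2 \<le> f (p w) (k w)" if "w \<in> X" for w
  proof -
    \<comment> \<open>One factor is exchanged at a time. The second summand keeps the weight at
      \<open>y\<close>, which is why the cut is made around \<open>p y\<close>.\<close>
    have "glue \<alpha> \<gamma> x w - glue \<alpha> \<gamma> y w = (\<alpha> (p x) (p w) - \<alpha> (p y) (p w)) * \<gamma> (k (\<sigma> (p w) x)) (k w)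
      + \<alpha> (p y) (p w) * (\<gamma> (k (\<sigma> (p w) x)) (k w) - \<gamma> (k (\<sigma> (p w) y)) (k w))"
      using that by (simp add: glue_def algebra_simps)
    then show ?thesis
      using cmod_add_power2_le by (metis (no_types, lifting) f_def mult.assoc norm_mult power_mult_distrib)
  qed
  then have "(\<Sum>\<^sub>\<infinity>w\<in>X. (cmod (glue \<alpha> \<gamma> x w - glue \<alpha> \<gamma> y w))\<^sup>2) \<le> infsum g Q"
    by (rule has_sum_mono [OF has_sum_infsum [OF unit_ell2_diff(1) [OF glue_unit glue_unit, OF x y]] F])
  also have "\<dots> \<le> 2 * A + 2 * (c * 1 + 4 * T)"
    by (rule has_sum_mono [OF has_sum_infsum [OF g] G gG])
  also have "\<dots> \<le> 2 * a + 2 * (c + 4 * t)"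
    using ca ta by (simp add: A_def T_def)
  finally show ?thesis .
qed

text \<open>If \<open>w\<close> is at distance at least \<open>T\<close> from \<open>x\<close>,
  either its fibre lies at distance at least \<open>S\<close> from \<open>p x\<close>, or, by the
  triangle inequality through \<open>\<sigma> (p w) x\<close>, it is at distance at least
  \<open>T - S\<close> from that point within its fibre. The two cases cost \<open>s\<close> and
  \<open>t\<close>.\<close>

lemma glue_tail:
  assumes x: "x \<in> X"
    and ta: "(\<Sum>\<^sub>\<infinity>q\<in>Q - Q.mball (p x) S. (cmod (\<alpha> (p x) q))\<^sup>2) \<le> s"
    and tg: "\<And>h. h \<in> K \<Longrightarrow> (\<Sum>\<^sub>\<infinity>w\<in>K - K.mball h (T - S). (cmod (\<gamma> h w))\<^sup>2) \<le> t"
  shows "(\<Sum>\<^sub>\<infinity>w\<in>X - X.mball x T. (cmod (glue \<alpha> \<gamma> x w))\<^sup>2) \<le> s + t"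
proof -
  define P where "P q = (\<Sum>\<^sub>\<infinity>h\<in>K - K.mball (k (\<sigma> q x)) (T - S). (cmod (\<gamma> (k (\<sigma> q x)) h))\<^sup>2)" for q
  define U where "U = (\<Sum>\<^sub>\<infinity>q\<in>Q - Q.mball (p x) S. (cmod (\<alpha> (p x) q))\<^sup>2)"
  have px: "p x \<in> Q"
    using x p_closed by auto
  have ks: "k (\<sigma> q x) \<in> K" if "q \<in> Q" for q
    using that x \<sigma> k_closed by blast
  define a where "a q = (if q \<in> Q.mball (p x) S then 0 else (cmod (\<alpha> (p x) q))\<^sup>2)" for q
  \<comment> \<open>One summand for each case, defined over all of \<open>Q\<close> and
    \<open>K\<close>. Points counted twice or lying inside the ball only enlarge this nonnegative
    majorant.\<close>
  define f where "f q h = a q * (cmod (\<gamma> (k (\<sigma> q x)) h))\<^sup>2 + (cmod (\<alpha> (p x) q))\<^sup>2 *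
    (if h \<in> K.mball (k (\<sigma> q x)) (T - S) then 0 else (cmod (\<gamma> (k (\<sigma> q x)) h))\<^sup>2)" for q h
  define g where "g q = a q * 1 + (cmod (\<alpha> (p x) q))\<^sup>2 * P q" for q
  have fg: "(f q has_sum g q) K" if "q \<in> Q" for q
    unfolding f_def g_def P_def using that
    by (intro has_sum_add has_sum_cmult_right \<gamma> has_sum_restrict has_sum_infsum ks tail_sum(1) [OF \<gamma>])
  have G: "((\<lambda>q. a q + t * (cmod (\<alpha> (p x) q))\<^sup>2) has_sum (U + t * 1)) Q"
    unfolding a_def U_def
    by (intro has_sum_add has_sum_cmult_right has_sum_restrict has_sum_infsum \<alpha> px tail_sum(1) [OF \<alpha>])
  have gG: "g q \<le> a q + t * (cmod (\<alpha> (p x) q))\<^sup>2" if q: "q \<in> Q" for q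
    using mult_left_mono [OF tg [OF ks [OF q]], of "(cmod (\<alpha> (p x) q))\<^sup>2"]
    by (simp add: g_def P_def mult.commute)
  have P0: "0 \<le> P q" for q
    unfolding P_def by (rule infsum_nonneg) auto
  have a0: "0 \<le> a q" for q
    by (simp add: a_def)
  have g: "g summable_on Q"
    by (rule summable_on_comparison_test [OF has_sum_imp_summable [OF G]])
      (use gG P0 a0 in \<open>auto simp: g_def\<close>)
  have f0: "0 \<le> f q h" for q h
    using a0 by (simp add: f_def)
  have F: "((\<lambda>w. f (p w) (k w)) has_sum infsum g Q) X"
    by (rule fibrewise_has_sum [OF fg f0 has_sum_infsum [OF g]])
  have le: "(cmod (glue \<alpha> \<gamma> x w))\<^sup>2 \<le> f (p w) (k w)" if w: "w \<in> X" "w \<notin> X.mball x T" for w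
  proof (cases "p w \<in> Q.mball (p x) S")
    case True
    note s = \<sigma> [OF x p_closed [OF w(1)]]
    have "dK (k (\<sigma> (p w) x)) (k w) = d (\<sigma> (p w) x) w"
      using s w by (intro fibre_isometry) auto
    moreover have "d x w \<le> d x (\<sigma> (p w) x) + d (\<sigma> (p w) x) w"
      using x s w by (intro X.triangle) auto
    ultimately have "k w \<notin> K.mball (k (\<sigma> (p w) x)) (T - S)"
      using True w s(3) x by auto
    then show ?thesis
      using a0 w by (simp add: f_def glue_def norm_mult power_mult_distrib del: K.in_mball)
  next
    case False
    then show ?thesis
      using w by (simp add: f_def a_def glue_def norm_mult power_mult_distrib del: Q.in_mball K.in_mball)
  qed
  have "(\<Sum>\<^sub>\<infinity>w\<in>X - X.mball x T. (cmod (glue \<alpha> \<gamma> x w))\<^sup>2) \<le> infsum g Q"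
    by (rule has_sum_mono_neutral [OF has_sum_infsum [OF tail_sum(1) [OF glue_unit [OF x]]] F])
      (use le f0 in auto)
  also have "\<dots> \<le> U + t * 1"
    by (rule has_sum_mono [OF has_sum_infsum [OF g] G gG])
  also have "\<dots> \<le> s + t"
    using ta by (simp add: U_def)
  finally show ?thesis .
qed

end

text \<open>The vectors \<open>glue \<alpha> \<gamma>\<close> do the work; what is left is the
  choice of constants. Uniform discreteness and bounded geometry are assumed of \<open>X\<close>
  itself.\<close>

theorem strongly_embeddable_total_space:
  assumes seQ: "strongly_embeddable Q dQ" and seK: "strongly_embeddable K dK"
    and ud: "uniformly_discrete X d" and bg: "bounded_geometry X d" and ne: "X \<noteq> {}"
  shows "strongly_embeddable X d"
  unfolding strongly_embeddable_def
proof (intro conjI allI impI)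
  show "Metric_space X d" ..
next
  fix R \<epsilon> :: real
  assume "0 < R" "0 < \<epsilon>"
  have neQ: "Q \<noteq> {}" and neK: "K \<noteq> {}"
    using ne p_closed k_closed by auto
  have \<epsilon>4: "0 < \<epsilon> / 4"
    using \<open>0 < \<epsilon>\<close> by simp
  obtain \<alpha> where \<alpha>u: "\<And>q. q \<in> Q \<Longrightarrow> ((\<lambda>w. (cmod (\<alpha> q w))\<^sup>2) has_sum 1) Q"
    and \<alpha>c: "\<And>u v. u \<in> Q \<Longrightarrow> v \<in> Q \<Longrightarrow> dQ u v \<le> R \<Longrightarrow>
      (\<Sum>\<^sub>\<infinity>w\<in>Q. (cmod (\<alpha> u w - \<alpha> v w))\<^sup>2) \<le> (\<epsilon> / 4)\<^sup>2"
    and \<alpha>t: "\<And>\<eta>. \<eta> > 0 \<Longrightarrow> \<exists>S0. \<forall>S\<ge>S0. \<forall>q\<in>Q.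
      (\<Sum>\<^sub>\<infinity>w\<in>Q - Q.mball q S. (cmod (\<alpha> q w))\<^sup>2) \<le> \<eta>"
    by (rule strongly_embeddableE [OF seQ neQ \<open>0 < R\<close> \<epsilon>4]) blast
  obtain S0 where S0: "\<And>S q. S \<ge> S0 \<Longrightarrow> q \<in> Q \<Longrightarrow>
      (\<Sum>\<^sub>\<infinity>w\<in>Q - Q.mball q S. (cmod (\<alpha> q w))\<^sup>2) \<le> \<epsilon>\<^sup>2 / 32"
    using \<alpha>t [of "\<epsilon>\<^sup>2 / 32"] \<open>0 < \<epsilon>\<close> by auto
  \<comment> \<open>Nonnegativity of \<open>S\<close> makes \<open>2 * R + 2 * S\<close> positive, a
    legitimate radius for the embeddability of \<open>K\<close>.\<close>
  define S where "S = max S0 0"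
  have R': "0 < 2 * R + 2 * S"
    using \<open>0 < R\<close> by (simp add: S_def)
  obtain \<gamma> where \<gamma>u: "\<And>q. q \<in> K \<Longrightarrow> ((\<lambda>w. (cmod (\<gamma> q w))\<^sup>2) has_sum 1) K"
    and \<gamma>c: "\<And>u v. u \<in> K \<Longrightarrow> v \<in> K \<Longrightarrow> dK u v \<le> 2 * R + 2 * S \<Longrightarrow>
      (\<Sum>\<^sub>\<infinity>w\<in>K. (cmod (\<gamma> u w - \<gamma> v w))\<^sup>2) \<le> (\<epsilon> / 4)\<^sup>2"
    and \<gamma>t: "\<And>\<eta>. \<eta> > 0 \<Longrightarrow> \<exists>S0. \<forall>S\<ge>S0. \<forall>q\<in>K.
      (\<Sum>\<^sub>\<infinity>w\<in>K - K.mball q S. (cmod (\<gamma> q w))\<^sup>2) \<le> \<eta>"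
    by (rule strongly_embeddableE [OF seK neK R' \<epsilon>4]) blast
  note unit = glue_unit [of \<alpha> \<gamma>, OF \<alpha>u \<gamma>u]
  have "glue \<alpha> \<gamma> x \<in> ell2 X \<and> ell2_norm X (glue \<alpha> \<gamma> x) = 1" if "x \<in> X" for x
    unfolding unit_ell2_iff using unit that by (auto simp: glue_def)
  moreover have "ell2_norm X (\<lambda>w. glue \<alpha> \<gamma> x w - glue \<alpha> \<gamma> y w) \<le> \<epsilon>"
    if xy: "x \<in> X" "y \<in> X" "d x y \<le> R" for x y
  proof -
    have "(\<Sum>\<^sub>\<infinity>w\<in>X. (cmod (glue \<alpha> \<gamma> x w - glue \<alpha> \<gamma> y w))\<^sup>2)
      \<le> 2 * (\<epsilon> / 4)\<^sup>2 + 2 * ((\<epsilon> / 4)\<^sup>2 + 4 * (\<epsilon>\<^sup>2 / 32))"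
    proof (rule glue_close [OF \<alpha>u \<gamma>u xy])
      show "0 \<le> (\<epsilon> / 4)\<^sup>2" by simp
      have "dQ (p x) (p y) \<le> R"
        using contraction xy by force
      then show "(\<Sum>\<^sub>\<infinity>q\<in>Q. (cmod (\<alpha> (p x) q - \<alpha> (p y) q))\<^sup>2) \<le> (\<epsilon> / 4)\<^sup>2"
        using xy p_closed by (intro \<alpha>c)
      show "(\<Sum>\<^sub>\<infinity>q\<in>Q - Q.mball (p y) S. (cmod (\<alpha> (p y) q))\<^sup>2) \<le> \<epsilon>\<^sup>2 / 32"
        using xy p_closed by (intro S0) (auto simp: S_def)
      show "(\<Sum>\<^sub>\<infinity>w\<in>K. (cmod (\<gamma> g w - \<gamma> h w))\<^sup>2) \<le> (\<epsilon> / 4)\<^sup>2"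
        if "g \<in> K" "h \<in> K" "dK g h \<le> 2 * R + 2 * S" for g h
        by (rule \<gamma>c [OF that])
    qed
    \<comment> \<open>The three contributions are 1/8, 1/8 and 1/4 of the square of
      \<open>\<epsilon>\<close>, one half in total.\<close>
    also have "\<dots> \<le> \<epsilon>\<^sup>2"
      by (simp add: power_divide)
    finally show ?thesis
      using \<open>0 < \<epsilon>\<close> by (simp add: ell2_norm_le_iff)
  qed
  moreover have "\<exists>T0. \<forall>T\<ge>T0. \<forall>x\<in>X. (\<Sum>\<^sub>\<infinity>w\<in>X - X.mball x T. (cmod (glue \<alpha> \<gamma> x w))\<^sup>2) \<le> \<eta>"
    if "\<eta> > 0" for \<eta>
  proof -
    obtain S1 where S1: "\<And>q. q \<in> Q \<Longrightarrow> (\<Sum>\<^sub>\<infinity>w\<in>Q - Q.mball q S1. (cmod (\<alpha> q w))\<^sup>2) \<le> \<eta> / 2"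
      using \<alpha>t [of "\<eta> / 2"] \<open>\<eta> > 0\<close> by auto
    obtain S2 where S2: "\<And>S h. S \<ge> S2 \<Longrightarrow> h \<in> K \<Longrightarrow>
        (\<Sum>\<^sub>\<infinity>w\<in>K - K.mball h S. (cmod (\<gamma> h w))\<^sup>2) \<le> \<eta> / 2"
      using \<gamma>t [of "\<eta> / 2"] \<open>\<eta> > 0\<close> by auto
    \<comment> \<open>One radius \<open>S1\<close> suffices for \<open>\<alpha>\<close>. The
      remaining radius \<open>T - S1\<close> varies with \<open>T\<close>, but it is at least
      \<open>S2\<close>.\<close>
    have "(\<Sum>\<^sub>\<infinity>w\<in>X - X.mball x T. (cmod (glue \<alpha> \<gamma> x w))\<^sup>2) \<le> \<eta> / 2 + \<eta> / 2"
      if "T \<ge> S1 + S2" "x \<in> X" for T x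
      using that by (intro glue_tail [OF \<alpha>u \<gamma>u, where S = S1] S1 S2 p_closed) auto
    then show ?thesis by auto
  qed
  then have "((\<lambda>S. SUP x\<in>X. \<Sum>\<^sub>\<infinity>w\<in>X - X.mball x S. (cmod (glue \<alpha> \<gamma> x w))\<^sup>2) \<longlongrightarrow> 0) at_top"
    by (simp add: tendsto_SUP_tail_iff [OF ne unit])
  ultimately show "\<exists>\<beta> :: 'a \<Rightarrow> 'a \<Rightarrow> complex.
        (\<forall>x\<in>X. \<beta> x \<in> ell2 X \<and> ell2_norm X (\<beta> x) = 1) \<and>
        (\<forall>x\<in>X. \<forall>y\<in>X. d x y \<le> R \<longrightarrow> ell2_norm X (\<lambda>w. \<beta> x w - \<beta> y w) \<le> \<epsilon>) \<and>
        ((\<lambda>S::real. SUP x\<in>X. \<Sum>\<^sub>\<infinity>w\<in>X - X.mball x S. (cmod (\<beta> x w))\<^sup>2) \<longlongrightarrow> 0) at_top"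
    by (intro exI [of _ "glue \<alpha> \<gamma>"]) simp
qed fact+

end

section \<open>From group extensions to metric fibrations\<close>

text \<open>Left translation by \<open>x\<close> carries the finite ball at the identity onto the
  ball at \<open>x\<close>, so one cardinality bounds them all.\<close>

lemma bounded_geometry_left_invariant:
  assumes "group G" "Metric_space (carrier G) d" "proper_metric (carrier G) d" "left_invariant G d"
  shows "bounded_geometry (carrier G) d"
  unfolding bounded_geometry_def
proof (intro allI impI)
  interpret group G by fact
  interpret Metric_space "carrier G" d by fact
  fix r :: real
  have "card (mball x r) \<le> card (mball \<one>\<^bsub>G\<^esub> r)" if x: "x \<in> carrier G" for x
  proof -
    have "mball x r \<subseteq> (\<lambda>y. x \<otimes>\<^bsub>G\<^esub> y) ` mball \<one>\<^bsub>G\<^esub> r"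
    proof
      fix y assume y: "y \<in> mball x r"
      have "d \<one>\<^bsub>G\<^esub> (inv\<^bsub>G\<^esub> x \<otimes>\<^bsub>G\<^esub> y) = d x (x \<otimes>\<^bsub>G\<^esub> (inv\<^bsub>G\<^esub> x \<otimes>\<^bsub>G\<^esub> y))"
        using assms(4) x y unfolding left_invariant_def by (metis in_mball inv_closed m_closed one_closed r_one)
      also have "x \<otimes>\<^bsub>G\<^esub> (inv\<^bsub>G\<^esub> x \<otimes>\<^bsub>G\<^esub> y) = y"
        using x y by (simp add: m_assoc [symmetric])
      finally show "y \<in> (\<lambda>y. x \<otimes>\<^bsub>G\<^esub> y) ` mball \<one>\<^bsub>G\<^esub> r"
        using x y by (intro image_eqI [of _ _ "inv\<^bsub>G\<^esub> x \<otimes>\<^bsub>G\<^esub> y"]) (auto simp: m_assoc [symmetric])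
    qed
    then show ?thesis
      using assms(3) by (meson one_closed proper_metric_def surj_card_le)
  qed
  then show "\<exists>N. \<forall>x\<in>carrier G. finite (mball x r) \<and> card (mball x r) \<le> N"
    using assms(3) unfolding proper_metric_def by blast
qed

theorem theorem4p14:
  fixes H :: "('h, 'x) monoid_scheme" and G :: "('g, 'y) monoid_scheme" and Q :: "('q, 'z) monoid_scheme"
    and i :: "'h \<Rightarrow> 'g" and p :: "'g \<Rightarrow> 'q" and dG :: "'g \<Rightarrow> 'g \<Rightarrow> real"
  assumes groups: "group H" "group G" "group Q"
    and countable: "countable (carrier H)" "countable (carrier G)" "countable (carrier Q)"
    and exact: "i \<in> mon H G" "kernel G Q p = i ` carrier H" "p \<in> epi G Q"
    and metric: "Metric_space (carrier G) dG" "uniformly_discrete (carrier G) dG"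
      "proper_metric (carrier G) dG" "left_invariant G dG"
    and H: "strongly_embeddable (carrier H) (\<lambda>x y. dG (i x) (i y))"
    and Q: "strongly_embeddable (carrier Q) (quotient_dist G p dG)"
  shows "strongly_embeddable (carrier G) dG"
proof -
  have ph: "p \<in> hom G Q" and im: "p ` carrier G = carrier Q"
    using exact(3) by (auto simp: epi_def)
  interpret group_hom G Q p
    using groups ph by (simp add: group_hom_def group_hom_axioms_def)
  interpret Metric_space "carrier G" dG by fact
  have inj: "inj_on i (carrier H)"
    using exact(1) by (auto simp: mon_def)
  define s where "s = inv_into (carrier G) p"
  have s: "s q \<in> carrier G" "p (s q) = q" if "q \<in> carrier Q" for q
    using that im by (auto simp: s_def inv_into_into f_inv_into_f)
  \<comment> \<open>By exactness, dividing \<open>w\<close> by the representative of its coset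
    leaves an element of the image of \<open>i\<close>.\<close>
  define k where "k w = inv_into (carrier H) i (inv\<^bsub>G\<^esub> s (p w) \<otimes>\<^bsub>G\<^esub> w)" for w
  have ker: "inv\<^bsub>G\<^esub> s (p w) \<otimes>\<^bsub>G\<^esub> w \<in> i ` carrier H" if "w \<in> carrier G" for w
    using that s [of "p w"] by (simp add: exact(2) [symmetric] kernel_def)
  have k: "k w \<in> carrier H" "i (k w) = inv\<^bsub>G\<^esub> s (p w) \<otimes>\<^bsub>G\<^esub> w" if "w \<in> carrier G" for w
    unfolding k_def using ker [OF that] by (fact inv_into_into, fact f_inv_into_f)
  have recover: "s (p w) \<otimes>\<^bsub>G\<^esub> i (k w) = w" if "w \<in> carrier G" for w
    unfolding k(2) [OF that] using that s(1) [of "p w"] by (simp add: G.m_assoc [symmetric])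
  note att = quotient_dist_attained [OF groups(2,3) ph metric(1,3,4)]
  have bij: "bij_betw (\<lambda>w. (p w, k w)) (carrier G) (carrier Q \<times> carrier H)"
  proof (rule bij_betw_imageI)
    show "inj_on (\<lambda>w. (p w, k w)) (carrier G)"
    proof (rule inj_onI)
      fix v w assume "v \<in> carrier G" "w \<in> carrier G" "(p v, k v) = (p w, k w)"
      then show "v = w"
        using recover by (metis Pair_inject)
    qed
    show "(\<lambda>w. (p w, k w)) ` carrier G = carrier Q \<times> carrier H"
    proof (intro equalityI subsetI)
      fix z assume "z \<in> carrier Q \<times> carrier H"
      then obtain q h where z: "z = (q, h)" "q \<in> carrier Q" "h \<in> carrier H" by auto
      have ih: "i h \<in> carrier G" "p (i h) = \<one>\<^bsub>Q\<^esub>"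
        using z exact(2) unfolding kernel_def by blast+
      \<comment> \<open>The inverse of the coordinate map, matching \<open>recover\<close>.\<close>
      define w where "w = s q \<otimes>\<^bsub>G\<^esub> i h"
      have w: "w \<in> carrier G" "p w = q"
        using ih s z by (auto simp: w_def)
      have "inv\<^bsub>G\<^esub> s (p w) \<otimes>\<^bsub>G\<^esub> w = i h"
        using ih s z w by (simp add: w_def G.m_assoc [symmetric])
      then have "k w = h"
        using inj z by (simp add: k_def)
      then show "z \<in> (\<lambda>w. (p w, k w)) ` carrier G"
        using w z by auto
    qed (use k in auto)
  qed
  \<comment> \<open>Points of one fibre are translated by the same inverse \<open>s (p w)\<close>,
    so left invariance applies.\<close>
  have iso: "dG (i (k z)) (i (k w)) = dG z w" if "z \<in> carrier G" "w \<in> carrier G" "p z = p w" for z w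
    unfolding k(2) [OF that(1)] k(2) [OF that(2)] that(3)
    using that s(1) [of "p w"] metric(4) by (simp add: left_invariant_def)
  \<comment> \<open>The minimum defining the quotient distance is attained with the first point
    prescribed to be \<open>x\<close>.\<close>
  have near: "\<exists>z\<in>carrier G. p z = q \<and> dG x z = quotient_dist G p dG (p x) q"
    if "x \<in> carrier G" "q \<in> carrier Q" for x q
    using att [OF that(1), of q] that im by metis
  \<comment> \<open>The pair \<open>x\<close>, \<open>y\<close> itself competes in that
    minimum.\<close>
  have contr: "quotient_dist G p dG (p x) (p y) \<le> dG x y" if "x \<in> carrier G" "y \<in> carrier G" for x y
    using att [OF that(1), of "p y"] that by (metis imageI)
  have "Metric_space (carrier H) (\<lambda>x y. dG (i x) (i y))"
    using H unfolding strongly_embeddable_def by (rule conjunct1)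
  then interpret metric_fibration "carrier G" dG "carrier Q" "quotient_dist G p dG" "carrier H"
    "\<lambda>x y. dG (i x) (i y)" p k
    by (intro metric_fibration.intro metric_fibration_axioms.intro metric(1) bij iso near contr
        Metric_space_quotient_dist [OF groups(2,3) exact(3) metric(1,3,4)])
  show ?thesis
    using Q H metric(2) bounded_geometry_left_invariant [OF groups(2) metric(1,3,4)]
    by (rule strongly_embeddable_total_space) (use G.one_closed in blast)
qed

end
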